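(* For $n\ge1$, $Q_n(x,z)=\Xi(P_n(x,z))$, where $\Xi$ is the linear operator sending $z^0x^k\mapsto z^1x^k$ and $z^1x^k\mapsto x^{k+1}$. In other words, for every $k$: the number of $\sigma\in\mathcal{S}_n$ beginning with an odd number and having $\overrightarrow{des}_E(\sigma)=k$ equals the number of $\pi\in\mathcal{S}_n$ beginning with an odd number and having $\overrightarrow{des}_O(\pi)=k$; and the number of $\sigma\in\mathcal{S}_n$ beginning with an even number and having $\overrightarrow{des}_E(\sigma)=k$ equals the number of $\pi\in\mathcal{S}_n$ beginning with an even number and having $\overrightarrow{des}_O(\pi)=k+1$.
   Context: $\mathcal{S}_n$ denotes the set of permutations $\sigma=\sigma_1\cdots\sigma_n$ of $\{1,\dots,n\}$. $\overrightarrow{des}_E(\sigma)$ (resp. $\overrightarrow{des}_O(\sigma)$) is the number of indices $i\in\{1,\dots,n-1\}$ with $\sigma_i>\sigma_{i+1}$ and $\sigma_{i+1}$ even (resp. odd). $P_n(x,z)=\sum_{\sigma\in\mathcal{S}_n}x^{\overrightarrow{des}_E(\sigma)}z^{\chi(\sigma_1\text{ even})}$ and $Q_n(x,z)=\sum_{\sigma\in\mathcal{S}_n}x^{\overrightarrow{des}_O(\sigma)}z^{\chi(\sigma_1\text{ odd})}$, where $\chi(\cdot)$ is $1$ if the condition holds and $0$ otherwise. *)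

theory Defs
  imports "HOL-Combinatorics.Permutations" "HOL-Computational_Algebra.Polynomial"
begin

definition Sym :: "nat \<Rightarrow> (nat \<Rightarrow> nat) set" where
  "Sym n = {\<sigma>. \<sigma> permutes {1..n}}"

definition des_E :: "nat \<Rightarrow> (nat \<Rightarrow> nat) \<Rightarrow> nat" where
  "des_E n \<sigma> = card {i \<in> {1..<n}. \<sigma> i > \<sigma> (i + 1) \<and> even (\<sigma> (i + 1))}"

definition des_O :: "nat \<Rightarrow> (nat \<Rightarrow> nat) \<Rightarrow> nat" where
  "des_O n \<sigma> = card {i \<in> {1..<n}. \<sigma> i > \<sigma> (i + 1) \<and> odd (\<sigma> (i + 1))}"

text \<open>
  A polynomial in \<open>x\<close> and \<open>z\<close> is an element of \<open>\<int>[x][z]\<close>, the outer variable being \<open>z\<close>;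
  the monomial \<open>x ^ k * z ^ j\<close> is \<open>monom (monom 1 k) j\<close>.
\<close>

definition P :: "nat \<Rightarrow> int poly poly" where
  "P n = (\<Sum>\<sigma>\<in>Sym n. monom (monom 1 (des_E n \<sigma>)) (of_bool (even (\<sigma> 1))))"

definition Q :: "nat \<Rightarrow> int poly poly" where
  "Q n = (\<Sum>\<sigma>\<in>Sym n. monom (monom 1 (des_O n \<sigma>)) (of_bool (odd (\<sigma> 1))))"

text \<open>
  The operator is only meaningful on polynomials of degree at most 1 in \<open>z\<close>; as a total function
  it sends every monomial of higher degree in \<open>z\<close> to 0. The lemmas below show that it is
  linear, that it has the prescribed values on monomials, and that these two properties
  determine it on polynomials of degree at most 1 in \<open>z\<close>.
\<close>

definition Xi :: "int poly poly \<Rightarrow> int poly poly" where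
  "Xi p = [: monom 1 1 * coeff p 1, coeff p 0 :]"

lemma Xi_add: "Xi (p + q) = Xi p + Xi q"
  by (simp add: Xi_def algebra_simps)

lemma Xi_smult: "Xi (smult [:c:] p) = smult [:c:] (Xi p)"
  by (simp add: Xi_def algebra_simps)

lemma Xi_z0: "Xi (monom (monom 1 k) 0) = monom (monom 1 k) 1"
  by (simp add: Xi_def monom_Suc monom_0)

lemma Xi_z1: "Xi (monom (monom 1 k) 1) = monom (monom 1 (k + 1)) 0"
  by (simp add: Xi_def mult_monom monom_0)

lemma Xi_unique:
  fixes L :: "int poly poly \<Rightarrow> int poly poly"
  assumes add: "\<And>p q. L (p + q) = L p + L q"
    and smult: "\<And>c p. L (smult [:c:] p) = smult [:c:] (L p)"
    and z0: "\<And>k. L (monom (monom 1 k) 0) = monom (monom 1 k) 1"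
    and z1: "\<And>k. L (monom (monom 1 k) 1) = monom (monom 1 (k + 1)) 0"
    and deg: "degree p \<le> 1"
  shows "L p = Xi p"
proof -
  have L0: "L 0 = 0" using add[of 0 0] by simp
  have X0: "Xi 0 = 0" by (simp add: Xi_def)
  have sumL: "L (sum f A) = (\<Sum>a\<in>A. L (f a))" if "finite A" for f and A :: "nat set"
    using that by (induction A rule: finite_induct) (auto simp: L0 add)
  have sumX: "Xi (sum f A) = (\<Sum>a\<in>A. Xi (f a))" if "finite A" for f and A :: "nat set"
    using that by (induction A rule: finite_induct) (auto simp: X0 Xi_add)
  have mon: "monom (monom c k) j = smult [:c:] (monom (monom 1 k) j)" for c :: int and k j
    by (simp add: smult_monom)
  have eq: "L (monom (monom c k) j) = Xi (monom (monom c k) j)" if "j \<le> 1" for c k j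
  proof -
    have "j = 0 \<or> j = 1" using that by auto
    then have "L (monom (monom 1 k) j) = Xi (monom (monom 1 k) j)"
      using z0 z1 Xi_z0 Xi_z1 by auto
    then show ?thesis by (subst (1 2) mon) (simp only: smult Xi_smult)
  qed
  have inner: "L (monom q j) = Xi (monom q j)" if "j \<le> 1" for q j
  proof -
    have "monom q j = (\<Sum>k\<le>degree q. monom (monom (coeff q k) k) j)"
      by (subst poly_as_sum_of_monoms[of q, symmetric])
        (simp add: poly_eq_iff coeff_sum)
    then show ?thesis using that by (simp add: sumL sumX eq)
  qed
  have p: "p = (\<Sum>j\<le>1. monom (coeff p j) j)"
    using poly_as_sum_of_monoms'[OF deg] by simp
  have "L (\<Sum>j\<le>1. monom (coeff p j) j) = Xi (\<Sum>j\<le>1. monom (coeff p j) j)"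
    unfolding sumL[OF finite_atMost] sumX[OF finite_atMost]
    by (rule sum.cong) (auto intro: inner)
  then show ?thesis using p by metis
qed

end

theory Submission
  imports Defs "HOL-Combinatorics.Multiset_Permutations"
begin

text \<open>
  Build permutations by inserting the largest letter. For a set of letters \<open>t\<close> (even or odd), the
  number of insertions leading to a given pair (number of descents with bottom in \<open>t\<close>, is the
  first letter in \<open>t\<close>) depends only on the pair of the original permutation, on its length and on
  the number of its letters in \<open>t\<close>. The map \<open>(k, False) \<mapsto> (k, True)\<close>, \<open>(k, True) \<mapsto> (k + 1, False)\<close>
  carries the transition rule for even bottoms to the one for odd bottoms, whence the
  distributions correspond by induction on the length.
\<close>

section \<open>Descents of lists and insertion of a letter\<close>

fun des_list :: "('a::linorder \<Rightarrow> bool) \<Rightarrow> 'a list \<Rightarrow> nat" where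
  "des_list t (x # y # ys) = of_bool (y < x \<and> t y) + des_list t (y # ys)"
| "des_list t _ = 0"

definition insert_nth :: "nat \<Rightarrow> 'a \<Rightarrow> 'a list \<Rightarrow> 'a list" where
  "insert_nth j m xs = take j xs @ m # drop j xs"

lemma insert_nth_0 [simp]: "insert_nth 0 m xs = m # xs"
  by (simp add: insert_nth_def)

lemma insert_nth_Suc_Cons [simp]: "insert_nth (Suc j) m (x # xs) = x # insert_nth j m xs"
  by (simp add: insert_nth_def)

lemma set_insert_nth [simp]: "set (insert_nth j m xs) = insert m (set xs)"
  by (metis append_take_drop_id insert_nth_def list.simps(15) set_append Un_insert_right)

lemma distinct_insert_nth [simp]: "distinct (insert_nth j m xs) \<longleftrightarrow> m \<notin> set xs \<and> distinct xs"
proof -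
  have "distinct (insert_nth j m xs) \<longleftrightarrow> distinct (m # (take j xs @ drop j xs))"
    unfolding insert_nth_def distinct.simps distinct_append set_append list.set by blast
  then show ?thesis by (simp only: append_take_drop_id distinct.simps)
qed

lemma remove1_insert_nth: "m \<notin> set xs \<Longrightarrow> remove1 m (insert_nth j m xs) = xs"
  by (simp add: insert_nth_def remove1_append) (metis append_take_drop_id in_set_takeD)

lemma takeWhile_insert_nth:
  assumes "m \<notin> set xs"
  shows "takeWhile (\<lambda>x. x \<noteq> m) (insert_nth j m xs) = take j xs"
proof -
  have "\<forall>x\<in>set (take j xs). x \<noteq> m"
    using assms by (auto dest: in_set_takeD)
  then show ?thesis
    unfolding insert_nth_def by (subst takeWhile_append2) auto
qed

lemma insert_nth_takeWhile_remove1: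
  "m \<in> set ys \<Longrightarrow> insert_nth (length (takeWhile (\<lambda>x. x \<noteq> m) ys)) m (remove1 m ys) = ys"
  by (induction ys) auto

lemma length_takeWhile_le_remove1:
  "m \<in> set ys \<Longrightarrow> length (takeWhile (\<lambda>x. x \<noteq> m) ys) \<le> length (remove1 m ys)"
  by (induction ys) auto

text \<open>Deleting \<open>m\<close> and recording how many letters preceded it inverts the
  insertion, so each arrangement of the larger set comes from exactly one word and one
  position.\<close>

lemma sum_permutations_of_set_insert:
  assumes "finite A" "m \<notin> A"
  shows "(\<Sum>ys\<in>permutations_of_set (insert m A). G ys) =
    (\<Sum>xs\<in>permutations_of_set A. \<Sum>j\<le>length xs. G (insert_nth j m xs))"
proof -
  have "(\<Sum>xs\<in>permutations_of_set A. \<Sum>j\<le>length xs. G (insert_nth j m xs)) =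
    (\<Sum>(xs, j)\<in>(SIGMA xs:permutations_of_set A. {..length xs}). G (insert_nth j m xs))"
    by (rule sum.Sigma) auto
  also have "\<dots> = (\<Sum>ys\<in>permutations_of_set (insert m A). G ys)"
    using assms
    by (intro sum.reindex_bij_witness[where j = "\<lambda>(xs, j). insert_nth j m xs"
          and i = "\<lambda>ys. (remove1 m ys, length (takeWhile (\<lambda>x. x \<noteq> m) ys))"])
      (auto simp: permutations_of_set_def remove1_insert_nth takeWhile_insert_nth
        insert_nth_takeWhile_remove1 length_takeWhile_le_remove1 set_remove1_eq)
  finally show ?thesis ..
qed

section \<open>Inserting a largest letter\<close>

text \<open>Behind \<open>x\<close>, the letter \<open>m\<close> is never a descent bottom, while
  its right neighbour always becomes one. The count thus grows, by one, exactly at the gaps whose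
  right neighbour satisfies \<open>t\<close> and was not a descent bottom before.\<close>

lemma sum_insert_nth_behind_hd:
  fixes h :: "nat \<Rightarrow> 'b::comm_ring_1"
  assumes "\<forall>y\<in>set (x # ys). y < m"
  shows "(\<Sum>j\<le>length ys. h (des_list t (x # insert_nth j m ys))) =
    (of_nat (length (filter t ys)) - of_nat (des_list t (x # ys))) * h (des_list t (x # ys) + 1) +
    (of_nat (length (x # ys)) - (of_nat (length (filter t ys)) - of_nat (des_list t (x # ys)))) *
      h (des_list t (x # ys))"
  using assms
proof (induction ys arbitrary: x h)
  case Nil
  then show ?case by auto
next
  case (Cons y zs)
  define b :: nat where "b = of_bool (y < x \<and> t y)"
  have m: "y < m" "\<not> m < x" using Cons.prems by auto
  have "(\<Sum>j\<le>length (y # zs). h (des_list t (x # insert_nth j m (y # zs)))) =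
    h (of_bool (t y) + des_list t (y # zs)) +
    (\<Sum>j\<le>length zs. h (b + des_list t (y # insert_nth j m zs)))"
    using m by (simp add: sum.atMost_Suc_shift b_def del: sum.atMost_Suc)
  then show ?case
    \<comment> \<open>For insertions further right the pair \<open>x\<close>, \<open>y\<close> stays
      adjacent; its contribution \<open>b\<close> is absorbed into the test function.\<close>
    using Cons.IH[of y "\<lambda>k. h (b + k)"] Cons.prems
    by (cases "t y"; cases "y < x") (simp_all add: b_def algebra_simps)
qed

text \<open>
  The coefficients are differences in a ring because this function is also evaluated at pairs
  that no permutation attains, where truncated subtraction would break \<open>swap_stat_insertion_step\<close>.
\<close>

definition insertion_step ::
    "nat \<Rightarrow> nat \<Rightarrow> bool \<Rightarrow> (nat \<Rightarrow> bool \<Rightarrow> 'b::comm_ring_1) \<Rightarrow> nat \<Rightarrow> bool \<Rightarrow> 'b" where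
  "insertion_step n c b g k f = g (of_bool f + k) b +
     ((of_nat c - of_bool f - of_nat k) * g (k + 1) f +
      (of_nat n - (of_nat c - of_bool f - of_nat k)) * g k f)"

text \<open>Insertion in front makes the old first letter a descent bottom. All other insertions
  keep the first letter, and \<open>c - of_bool f\<close> counts the letters in \<open>t\<close>
  behind it.\<close>

lemma sum_insert_nth:
  assumes "xs \<noteq> []" "\<forall>y\<in>set xs. y < m"
  shows "(\<Sum>j\<le>length xs. g (des_list t (insert_nth j m xs)) (t (hd (insert_nth j m xs)))) =
    insertion_step (length xs) (length (filter t xs)) (t m) g (des_list t xs) (t (hd xs))"
proof -
  obtain x ys where xs: "xs = x # ys" using assms(1) by (cases xs) auto
  have "(\<Sum>j\<le>length xs. g (des_list t (insert_nth j m xs)) (t (hd (insert_nth j m xs)))) =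
    g (of_bool (t x) + des_list t xs) (t m) +
    (\<Sum>j\<le>length ys. g (des_list t (x # insert_nth j m ys)) (t x))"
    using assms(2) by (simp add: xs sum.atMost_Suc_shift del: sum.atMost_Suc)
  then show ?thesis
    using assms(2) sum_insert_nth_behind_hd[of x ys m "\<lambda>k. g k (t x)" t]
    by (simp add: xs insertion_step_def)
qed

section \<open>The recurrence from \<open>n\<close> to \<open>Suc n\<close>\<close>

lemma length_filter_permutations_of_set:
  assumes "xs \<in> permutations_of_set A"
  shows "length (filter t xs) = card {a \<in> A. t a}"
  using assms by (auto simp: permutations_of_set_def distinct_length_filter Int_def conj_commute)

lemma card_even_atLeastAtMost: "card {a \<in> {1..n}. even a} = n div 2" for n :: nat
proof (induction n)
  case (Suc n)
  have "{a \<in> {1..Suc n}. even a} =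
      (if even (Suc n) then insert (Suc n) {a \<in> {1..n}. even a} else {a \<in> {1..n}. even a})"
    by (auto simp: le_Suc_eq)
  with Suc show ?case by (auto simp: card_insert_if)
qed simp

lemma card_odd_atLeastAtMost: "card {a \<in> {1..n}. odd a} = Suc n div 2" for n :: nat
proof (induction n)
  case (Suc n)
  have "{a \<in> {1..Suc n}. odd a} =
      (if odd (Suc n) then insert (Suc n) {a \<in> {1..n}. odd a} else {a \<in> {1..n}. odd a})"
    by (auto simp: le_Suc_eq)
  with Suc show ?case by (auto simp: card_insert_if)
qed simp

lemma sum_permutations_Suc:
  assumes "n \<ge> 1"
  shows "(\<Sum>ys\<in>permutations_of_set {1..Suc n}. g (des_list t ys) (t (hd ys))) =
    (\<Sum>xs\<in>permutations_of_set {1..n}.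
      insertion_step n (card {a \<in> {1..n}. t a}) (t (Suc n)) g (des_list t xs) (t (hd xs)))"
proof -
  have "{1..Suc n} = insert (Suc n) {1..n}" by auto
  then have "(\<Sum>ys\<in>permutations_of_set {1..Suc n}. g (des_list t ys) (t (hd ys))) =
    (\<Sum>xs\<in>permutations_of_set {1..n}. \<Sum>j\<le>length xs.
      g (des_list t (insert_nth j (Suc n) xs)) (t (hd (insert_nth j (Suc n) xs))))"
    by (simp add: sum_permutations_of_set_insert)
  also have "\<dots> = (\<Sum>xs\<in>permutations_of_set {1..n}.
      insertion_step n (card {a \<in> {1..n}. t a}) (t (Suc n)) g (des_list t xs) (t (hd xs)))"
  proof (rule sum.cong[OF refl])
    fix xs assume xs: "xs \<in> permutations_of_set {1..n}"
    then have "set xs = {1..n}" "length xs = n"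
      by (auto simp: permutations_of_setD length_finite_permutations_of_set)
    with assms length_filter_permutations_of_set[OF xs, of t]
    show "(\<Sum>j\<le>length xs. g (des_list t (insert_nth j (Suc n) xs)) (t (hd (insert_nth j (Suc n) xs)))) =
      insertion_step n (card {a \<in> {1..n}. t a}) (t (Suc n)) g (des_list t xs) (t (hd xs))"
      by (subst sum_insert_nth) auto
  qed
  finally show ?thesis .
qed

section \<open>Exchanging even and odd\<close>

text \<open>The map on pairs, acting on test functions by composition. If \<open>g\<close> sends a
  pair to its monomial, this is the effect of \<open>Xi\<close>.\<close>

definition swap_stat :: "(nat \<Rightarrow> bool \<Rightarrow> 'b) \<Rightarrow> nat \<Rightarrow> bool \<Rightarrow> 'b" where
  "swap_stat g k f = (if f then g (k + 1) False else g k True)"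

text \<open>If \<open>n\<close> is even and \<open>f\<close> false, or \<open>n\<close> odd and
  \<open>f\<close> true, the coefficients of the two sides differ by one and the front insertions
  make up for it. In the other two cases the sides agree term by term.\<close>

lemma swap_stat_insertion_step:
  "swap_stat (insertion_step n (Suc n div 2) (odd (Suc n)) g) k f =
    insertion_step n (n div 2) (even (Suc n)) (swap_stat g) k f"
proof (cases "even n")
  case True
  then obtain p where "n = 2 * p" by blast
  then show ?thesis
    by (cases f) (simp_all add: swap_stat_def insertion_step_def algebra_simps)
next
  case False
  then obtain p where "n = 2 * p + 1" by (elim oddE)
  then show ?thesis
    by (cases f) (simp_all add: swap_stat_def insertion_step_def algebra_simps)
qed

text \<open>Quantifying over \<open>g\<close> expresses equality of distributions and lets the
  induction hypothesis be applied to \<open>insertion_step\<close> of \<open>g\<close>.\<close>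

lemma sum_permutations_odd_eq_even:
  fixes g :: "nat \<Rightarrow> bool \<Rightarrow> 'b::comm_ring_1" and n :: nat
  assumes "n \<ge> 1"
  shows "(\<Sum>xs\<in>permutations_of_set {1..n}. g (des_list odd xs) (odd (hd xs))) =
    (\<Sum>xs\<in>permutations_of_set {1..n}. swap_stat g (des_list even xs) (even (hd xs)))"
  using assms
proof (induction n arbitrary: g rule: dec_induct)
  case base
  \<comment> \<open>The only word is \<open>[1]\<close>, with pair \<open>(0, True)\<close> for odd
    and \<open>(0, False)\<close> for even.\<close>
  then show ?case by (simp add: swap_stat_def)
next
  case (step n)
  show ?case
    unfolding sum_permutations_Suc[OF step.hyps(1), of g odd]
      sum_permutations_Suc[OF step.hyps(1), of "swap_stat g" even]
      card_even_atLeastAtMost card_odd_atLeastAtMost step.IH swap_stat_insertion_step ..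
qed

section \<open>From lists back to functions\<close>

lemma des_list_map_upt:
  "des_list t (map \<sigma> [a..<Suc (a + n)]) =
    card {i \<in> {a..<a + n}. \<sigma> i > \<sigma> (i + 1) \<and> t (\<sigma> (i + 1))}"
proof (induction n arbitrary: a)
  case 0
  then show ?case by simp
next
  case (Suc n)
  let ?D = "\<lambda>i. \<sigma> i > \<sigma> (i + 1) \<and> t (\<sigma> (i + 1))"
  have "{i \<in> {a..<a + Suc n}. ?D i} =
      (if ?D a then insert a {i \<in> {Suc a..<Suc a + n}. ?D i} else {i \<in> {Suc a..<Suc a + n}. ?D i})"
    by (auto simp: le_less Suc_le_eq)
  then have "card {i \<in> {a..<a + Suc n}. ?D i} =
      of_bool (?D a) + card {i \<in> {Suc a..<Suc a + n}. ?D i}"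
    by simp
  moreover have "des_list t (map \<sigma> [a..<Suc (a + Suc n)]) =
      of_bool (?D a) + des_list t (map \<sigma> [Suc a..<Suc (Suc a + n)])"
    by (simp add: upt_conv_Cons del: upt_Suc)
  ultimately show ?case by (simp only: Suc.IH)
qed

lemma bij_betw_Sym_permutations_of_set:
  "bij_betw (\<lambda>\<sigma>. map \<sigma> [1..<Suc n]) (Sym n) (permutations_of_set {1..n})"
proof -
  let ?f = "\<lambda>\<sigma>. map \<sigma> [1..<Suc n] :: nat list"
  have inj: "inj_on ?f (Sym n)"
  proof (rule inj_onI)
    fix \<sigma> \<tau> assume \<sigma>: "\<sigma> \<in> Sym n" and \<tau>: "\<tau> \<in> Sym n" and eq: "?f \<sigma> = ?f \<tau>"
    have "\<sigma> i = \<tau> i" if "i \<in> {1..n}" for i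
      using eq that by (auto simp: map_eq_conv simp del: upt_Suc)
    with \<sigma> \<tau> show "\<sigma> = \<tau>"
      unfolding Sym_def by (metis mem_Collect_eq permutes_not_in ext)
  qed
  have "?f \<sigma> \<in> permutations_of_set {1..n}" if "\<sigma> \<in> Sym n" for \<sigma>
  proof -
    have "\<sigma> permutes {1..n}" using that by (simp add: Sym_def)
    then show ?thesis
      by (intro permutations_of_setI)
        (auto simp: distinct_map permutes_inj_on atLeastLessThanSuc_atLeastAtMost permutes_image
          simp del: upt_Suc)
  qed
  then have "?f ` Sym n \<subseteq> permutations_of_set {1..n}" by blast
  \<comment> \<open>Surjectivity follows by counting: both sets have \<open>fact n\<close>
    elements.\<close>
  moreover have "card (?f ` Sym n) = card (permutations_of_set {1..n})"
    unfolding card_image[OF inj] using card_permutations[of "{1..n}" n] by (simp add: Sym_def)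
  ultimately have "?f ` Sym n = permutations_of_set {1..n}"
    by (intro card_subset_eq) auto
  with inj show ?thesis by (simp add: bij_betw_def)
qed

lemma sum_Sym_eq_sum_permutations:
  assumes "n \<ge> 1"
  shows "(\<Sum>\<sigma>\<in>Sym n. g (card {i \<in> {1..<n}. \<sigma> i > \<sigma> (i + 1) \<and> t (\<sigma> (i + 1))}) (t (\<sigma> 1))) =
    (\<Sum>xs\<in>permutations_of_set {1..n}. g (des_list t xs) (t (hd xs)))"
proof -
  have "des_list t (map \<sigma> [1..<Suc n]) =
      card {i \<in> {1..<n}. \<sigma> i > \<sigma> (i + 1) \<and> t (\<sigma> (i + 1))}" for \<sigma> :: "nat \<Rightarrow> nat"
    using des_list_map_upt[of t \<sigma> 1 "n - 1"] assms by simp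
  moreover have "hd (map \<sigma> [1..<Suc n]) = \<sigma> 1" for \<sigma> :: "nat \<Rightarrow> nat"
    using assms by (simp add: upt_conv_Cons del: upt_Suc)
  ultimately show ?thesis
    by (simp only: sum.reindex_bij_betw[OF bij_betw_Sym_permutations_of_set, symmetric])
qed

lemma sum_Sym_odd_eq_even:
  fixes g :: "nat \<Rightarrow> bool \<Rightarrow> 'b::comm_ring_1"
  assumes "n \<ge> 1"
  shows "(\<Sum>\<sigma>\<in>Sym n. g (des_O n \<sigma>) (odd (\<sigma> 1))) =
    (\<Sum>\<sigma>\<in>Sym n. swap_stat g (des_E n \<sigma>) (even (\<sigma> 1)))"
  unfolding des_O_def des_E_def
  using sum_Sym_eq_sum_permutations[OF assms, of g odd]
    sum_Sym_eq_sum_permutations[OF assms, of "swap_stat g" even]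
    sum_permutations_odd_eq_even[OF assms, of g]
  by simp

section \<open>Polynomials and counts\<close>

lemma finite_Sym: "finite (Sym n)"
  by (simp add: Sym_def finite_permutations)

lemma Xi_sum: "Xi (sum f A) = (\<Sum>a\<in>A. Xi (f a))"
  by (induction A rule: infinite_finite_induct) (simp_all add: Xi_add, simp_all add: Xi_def)

theorem theorem5p3:
  fixes n :: nat
  assumes "n \<ge> 1"
  shows "Q n = Xi (P n) \<and>
    (\<forall>k. card {\<sigma> \<in> Sym n. odd (\<sigma> 1) \<and> des_E n \<sigma> = k}
       = card {\<pi> \<in> Sym n. odd (\<pi> 1) \<and> des_O n \<pi> = k}) \<and>
    (\<forall>k. card {\<sigma> \<in> Sym n. even (\<sigma> 1) \<and> des_E n \<sigma> = k}
       = card {\<pi> \<in> Sym n. even (\<pi> 1) \<and> des_O n \<pi> = k + 1})"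
proof (intro conjI allI)
  have "Xi (monom (monom 1 k) (of_bool f)) =
      swap_stat (\<lambda>k f. monom (monom 1 k) (of_bool f)) k f" for k f
    using Xi_z0[of k] Xi_z1[of k] by (cases f) (simp_all add: swap_stat_def)
  then show "Q n = Xi (P n)"
    unfolding P_def Q_def Xi_sum
    by (simp only: sum_Sym_odd_eq_even[OF assms, of "\<lambda>k f. monom (monom 1 k) (of_bool f)"])
next
  fix k
  \<comment> \<open>Cardinalities become sums of integer indicators, since the transfer identity
    needs ring-valued test functions.\<close>
  have card: "int (card {\<sigma> \<in> Sym n. R \<sigma>}) = (\<Sum>\<sigma>\<in>Sym n. of_bool (R \<sigma>))" for R
    using finite_Sym by (simp add: of_bool_def sum.If_cases Int_def)
  have "int (card {\<pi> \<in> Sym n. odd (\<pi> 1) \<and> des_O n \<pi> = k}) =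
      int (card {\<sigma> \<in> Sym n. odd (\<sigma> 1) \<and> des_E n \<sigma> = k})"
    unfolding card sum_Sym_odd_eq_even[OF assms, of "\<lambda>j f. of_bool (f \<and> j = k)"]
    by (auto simp: swap_stat_def intro!: sum.cong)
  then show "card {\<sigma> \<in> Sym n. odd (\<sigma> 1) \<and> des_E n \<sigma> = k} =
      card {\<pi> \<in> Sym n. odd (\<pi> 1) \<and> des_O n \<pi> = k}"
    by linarith
  \<comment> \<open>A word not starting with an odd letter has flag \<open>False\<close>. After the
    swap, this test function is nonzero only at \<open>(k, True)\<close>, an even first letter with
    \<open>k\<close> descents.\<close>
  have "int (card {\<pi> \<in> Sym n. even (\<pi> 1) \<and> des_O n \<pi> = k + 1}) =
      int (card {\<sigma> \<in> Sym n. even (\<sigma> 1) \<and> des_E n \<sigma> = k})"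
    unfolding card
    using sum_Sym_odd_eq_even[OF assms, of "\<lambda>j f. of_bool (\<not> f \<and> j = k + 1) :: int"]
    by (auto simp: swap_stat_def intro!: sum.cong)
  then show "card {\<sigma> \<in> Sym n. even (\<sigma> 1) \<and> des_E n \<sigma> = k} =
      card {\<pi> \<in> Sym n. even (\<pi> 1) \<and> des_O n \<pi> = k + 1}"
    by linarith
qed

end
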